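(* Let $n$ and $p\geqslant 1$ be positive integers and let $A_1,\ldots,A_n$ be Hermitian positive semidefinite complex matrices of the same size. For $1\leqslant r\leqslant n$ put $$S_{r,[n]}^p := \sum_{I\subseteq\{1,\ldots,n\},\ |I|=r}\Bigl(\sum_{i\in I}A_i\Bigr)^{\otimes p}.$$ Then for all integers $k,\ell,m$ with $1\leqslant k<\ell<m\leqslant n$, in the Löwner order, $$\frac{m-\ell}{k\binom{n}{k}}\, S_{k,[n]}^p + \frac{\ell-k}{m\binom{n}{m}}\, S_{m,[n]}^p \ \geqslant\ \frac{m-k}{\ell\binom{n}{\ell}}\, S_{\ell,[n]}^p.$$
   Context: For a matrix $A$, $A^{\otimes p}=A\otimes\cdots\otimes A$ ($p$ factors) is the Kronecker (tensor) power. For Hermitian $X,Y$ of the same size, $X\geqslant Y$ (Löwner order) means that $X-Y$ is positive semidefinite. *)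

theory Defs
  imports "Jordan_Normal_Form.Schur_Decomposition"
begin

definition kronecker :: "complex mat \<Rightarrow> complex mat \<Rightarrow> complex mat" where
  "kronecker A B = mat (dim_row A * dim_row B) (dim_col A * dim_col B)
     (\<lambda>(i, j). A $$ (i div dim_row B, j div dim_col B) * B $$ (i mod dim_row B, j mod dim_col B))"

primrec kronecker_power :: "complex mat \<Rightarrow> nat \<Rightarrow> complex mat" where
  "kronecker_power A 0 = 1\<^sub>m 1"
| "kronecker_power A (Suc p) = kronecker A (kronecker_power A p)"

(* mat_adjoint is the conjugate transpose, so a hermitian matrix is automatically square. *)
definition hermitian :: "complex mat \<Rightarrow> bool" where
  "hermitian A \<longleftrightarrow> mat_adjoint A = A"

(* The order on complex numbers is that of Complex_Order: 0 \<le> z says that z is real and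
   nonnegative.  The scalar (A *\<^sub>v v) \<bullet>c v is v* A v. *)
definition positive_semidefinite :: "complex mat \<Rightarrow> bool" where
  "positive_semidefinite A \<longleftrightarrow>
     hermitian A \<and> (\<forall>v \<in> carrier_vec (dim_row A). 0 \<le> (A *\<^sub>v v) \<bullet>c v)"

(* The order symbol \<le> on type mat is entrywise, hence the separate notation.
   Equality of dimensions is required because subtraction on mat is total. *)
definition loewner_ge :: "complex mat \<Rightarrow> complex mat \<Rightarrow> bool" (infix "\<ge>\<^sub>L" 50) where
  "X \<ge>\<^sub>L Y \<longleftrightarrow> hermitian X \<and> hermitian Y \<and> dim_row X = dim_row Y \<and>
     positive_semidefinite (X - Y)"

(* Type mat has no zero element common to all dimensions, so sums of matrices are taken in the
   module of d-by-d matrices. *)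
definition msum :: "nat \<Rightarrow> ('i \<Rightarrow> complex mat) \<Rightarrow> 'i set \<Rightarrow> complex mat" where
  "msum d F I = finsum (module_mat TYPE(complex) d d) F I"

definition S_sum :: "nat \<Rightarrow> (nat \<Rightarrow> complex mat) \<Rightarrow> nat \<Rightarrow> nat \<Rightarrow> nat \<Rightarrow> complex mat" where
  "S_sum d A n p r =
     msum (d ^ p) (\<lambda>I. kronecker_power (msum d A I) p) {I. I \<subseteq> {1..n} \<and> card I = r}"

lemma kronecker_carrier:
  "A \<in> carrier_mat a b \<Longrightarrow> B \<in> carrier_mat c d \<Longrightarrow> kronecker A B \<in> carrier_mat (a * c) (b * d)"
  unfolding kronecker_def by auto

lemma kronecker_power_carrier:
  assumes "A \<in> carrier_mat d d"
  shows "kronecker_power A p \<in> carrier_mat (d ^ p) (d ^ p)"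
proof (induction p)
  case 0
  show ?case by simp
next
  case (Suc p)
  show ?case
    using kronecker_carrier[OF assms Suc] by simp
qed

lemma kronecker_power_1: "kronecker_power A (Suc 0) = A"
  by (rule eq_matI) (simp_all add: kronecker_def)

lemma abelian_monoid_module_mat: "abelian_monoid (module_mat TYPE(complex) d d)"
  by (rule abelian_group.axioms(1)[OF abelian_group_mat])

lemma msum_carrier:
  assumes "\<And>i. i \<in> I \<Longrightarrow> F i \<in> carrier_mat d d"
  shows "msum d F I \<in> carrier_mat d d"
  using abelian_monoid.finsum_closed[OF abelian_monoid_module_mat, of F I d] assms
  by (simp add: msum_def module_mat_simps Pi_def)

lemma msum_index:
  assumes "finite I" "\<And>i. i \<in> I \<Longrightarrow> F i \<in> carrier_mat d d" "a < d" "b < d"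
  shows "msum d F I $$ (a, b) = (\<Sum>i\<in>I. F i $$ (a, b))"
  using assms(1,2)
proof (induction I rule: finite_induct)
  case empty
  show ?case
    using assms(3,4)
    by (simp add: msum_def abelian_monoid.finsum_empty[OF abelian_monoid_module_mat] module_mat_simps)
next
  case (insert x I)
  have "msum d F (insert x I) = F x + msum d F I"
    using abelian_monoid.finsum_insert[OF abelian_monoid_module_mat, of I x F d] insert
    by (simp add: msum_def module_mat_simps Pi_def)
  moreover have "msum d F I \<in> carrier_mat d d"
    using insert by (intro msum_carrier) auto
  ultimately show ?case
    using insert assms(3,4) by simp
qed

end

theory Submission
  imports Defs
begin

text \<open>
  Multiplying out the tensor power of \<open>\<Sum>i\<in>I. A i\<close> gives one term for each word \<open>w\<close> of length
  \<open>p\<close> over the alphabet \<open>I\<close>, namely the Kronecker product \<open>A w\<^sub>1 \<otimes> \<dots> \<otimes> A w\<^sub>p\<close>. In the sum over all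
  \<open>r\<close>-element sets \<open>I\<close>, a word with exactly \<open>s\<close> distinct letters therefore occurs as often as its
  letters have an \<open>r\<close>-element superset, that is \<open>(n - s) choose (r - s)\<close> times if \<open>s \<le> r\<close>, and never otherwise. After division by
  \<open>r * (n choose r)\<close> its coefficient becomes
    \<open>((r - 1) choose (s - 1)) / (s * (n choose s))\<close>   (lemma \<open>normalised_count\<close>),
  in which \<open>r\<close> occurs only in the numerator. By Pascal's rule the first difference of
  \<open>(r - 1) choose (s - 1)\<close> is again a binomial coefficient that grows with \<open>r\<close>, so the coefficient
  is a convex function of \<open>r \<ge> 1\<close>. The asserted inequality compares the values at \<open>k < l < m\<close> in
  exactly the way in which a convex function lies below its secants; hence the difference of its
  two sides is a combination of the matrices \<open>A w\<^sub>1 \<otimes> \<dots> \<otimes> A w\<^sub>p\<close> with nonnegative coefficients.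
  The condition \<open>p \<ge> 1\<close> guarantees \<open>s \<ge> 1\<close> here.

  It remains to see that a Kronecker product of positive semidefinite matrices is positive
  semidefinite. A positive semidefinite matrix is a sum of rank-one matrices \<open>u u*\<close>
  (\<open>psd_kernel_imp_gram\<close>, by Cholesky elimination), and the Kronecker product of \<open>u u*\<close> and
  \<open>v v*\<close> is the rank-one matrix belonging to \<open>u \<otimes> v\<close>.
\<close>

section \<open>Positive semidefinite kernels are Gram kernels\<close>

text \<open>
  Kernels on an arbitrary index set replace matrices here because the elimination argument removes
  one index at a time, which would need a change of dimension for matrices.
\<close>

definition psd_kernel :: "'i set \<Rightarrow> ('i \<Rightarrow> 'i \<Rightarrow> complex) \<Rightarrow> bool" where
  "psd_kernel I a \<longleftrightarrow> (\<forall>i\<in>I. \<forall>j\<in>I. cnj (a i j) = a j i) \<and>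
     (\<forall>x. 0 \<le> (\<Sum>i\<in>I. \<Sum>j\<in>I. cnj (x i) * a i j * x j))"

text \<open>
  The matrix \<open>\<Sum>u. u u*\<close>. The vectors form a list, so that vectors may repeat, and the
  Kronecker product of two such matrices corresponds to pairing the lists.
\<close>

definition gram_kernel :: "('i \<Rightarrow> complex) list \<Rightarrow> 'i \<Rightarrow> 'i \<Rightarrow> complex" where
  "gram_kernel us i j = (\<Sum>u\<leftarrow>us. u i * cnj (u j))"

lemma complex_cnj_mult_nonneg: "0 \<le> cnj z * z"
  by (simp add: less_eq_complex_def)

lemma psd_kernel_cnj: "psd_kernel I a \<Longrightarrow> i \<in> I \<Longrightarrow> j \<in> I \<Longrightarrow> cnj (a i j) = a j i"
  unfolding psd_kernel_def by simp

lemma psd_kernel_cong: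
  assumes "\<And>i j. i \<in> I \<Longrightarrow> j \<in> I \<Longrightarrow> a i j = b i j"
  shows "psd_kernel I a \<longleftrightarrow> psd_kernel I b"
  unfolding psd_kernel_def using assms by (auto cong: sum.cong)

lemma psd_kernel_gram: "psd_kernel I (gram_kernel us)"
  unfolding psd_kernel_def
proof (intro conjI ballI allI)
  show "cnj (gram_kernel us i j) = gram_kernel us j i" for i j
    by (induction us) (auto simp: gram_kernel_def)
  show "0 \<le> (\<Sum>i\<in>I. \<Sum>j\<in>I. cnj (x i) * gram_kernel us i j * x j)" for x
  proof (induction us)
    case Nil
    show ?case by (simp add: gram_kernel_def)
  next
    case (Cons u us)
    have "(\<Sum>i\<in>I. \<Sum>j\<in>I. cnj (x i) * gram_kernel (u # us) i j * x j)
        = cnj (\<Sum>i\<in>I. cnj (u i) * x i) * (\<Sum>j\<in>I. cnj (u j) * x j)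
          + (\<Sum>i\<in>I. \<Sum>j\<in>I. cnj (x i) * gram_kernel us i j * x j)"
      by (simp add: gram_kernel_def sum_product ring_distribs sum.distrib mult_ac)
    also have "\<dots> \<ge> 0"
      using complex_cnj_mult_nonneg Cons.IH by (rule add_nonneg_nonneg)
    finally show ?case .
  qed
qed

text \<open>
  Splitting off a pivot index \<open>p\<close> turns the quadratic form into a quadratic polynomial in the single
  coordinate \<open>x p\<close>.
\<close>

lemma form_insert:
  fixes a :: "'i \<Rightarrow> 'i \<Rightarrow> complex"
  assumes "finite I" "p \<notin> I"
  shows "(\<Sum>i\<in>insert p I. \<Sum>j\<in>insert p I. cnj (x i) * a i j * x j)
       = cnj (x p) * a p p * x p + cnj (x p) * (\<Sum>j\<in>I. a p j * x j)
         + (\<Sum>i\<in>I. cnj (x i) * a i p) * x p + (\<Sum>i\<in>I. \<Sum>j\<in>I. cnj (x i) * a i j * x j)"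
  using assms by (simp add: sum.distrib sum_distrib_left sum_distrib_right mult_ac)

text \<open>
  The pivot coordinate may be given any value \<open>t\<close>. Each step of the elimination is one choice of
  \<open>t\<close>: the value 0 restricts the kernel, a large multiple of \<open>- a p j\<close> handles a zero pivot, and the
  minimiser of the polynomial gives the Schur complement.
\<close>

lemma psd_kernel_insert_nonneg:
  fixes a :: "'i \<Rightarrow> 'i \<Rightarrow> complex"
  assumes "psd_kernel (insert p I) a" "finite I" "p \<notin> I"
  shows "0 \<le> t * cnj t * a p p + cnj t * (\<Sum>j\<in>I. a p j * x j)
             + t * cnj (\<Sum>j\<in>I. a p j * x j) + (\<Sum>i\<in>I. \<Sum>j\<in>I. cnj (x i) * a i j * x j)"
proof -
  let ?y = "x(p := t)"
  have cong: "(\<Sum>j\<in>I. a i j * ?y j) = (\<Sum>j\<in>I. a i j * x j)" 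
       "(\<Sum>i\<in>I. \<Sum>j\<in>I. cnj (?y i) * a i j * ?y j) = (\<Sum>i\<in>I. \<Sum>j\<in>I. cnj (x i) * a i j * x j)" for i
    using assms(3) by (auto intro!: sum.cong)
  have c: "(\<Sum>i\<in>I. cnj (?y i) * a i p) = cnj (\<Sum>j\<in>I. a p j * x j)"
    unfolding cnj_sum using psd_kernel_cnj[OF assms(1)] assms(3)
    by (intro sum.cong) auto
  have "0 \<le> (\<Sum>i\<in>insert p I. \<Sum>j\<in>insert p I. cnj (?y i) * a i j * ?y j)"
    using assms(1) unfolding psd_kernel_def by blast
  then show ?thesis
    unfolding form_insert[OF assms(2,3)] cong c by (simp add: mult_ac)
qed

lemma psd_kernel_subset:
  assumes "psd_kernel (insert p I) a" "finite I" "p \<notin> I"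
  shows "psd_kernel I a"
  using psd_kernel_cnj[OF assms(1)] psd_kernel_insert_nonneg[OF assms, of 0]
  unfolding psd_kernel_def by simp

text \<open>
  With a zero pivot the form is affine in \<open>t\<close>, hence unbounded below unless the linear coefficient
  vanishes. The constant \<open>c\<close> is chosen so large that the linear part outweighs \<open>a j j\<close>.
\<close>

lemma psd_kernel_zero_pivot:
  fixes a :: "'i \<Rightarrow> 'i \<Rightarrow> complex"
  assumes psd: "psd_kernel (insert p I) a" and "finite I" "p \<notin> I" and zero: "a p p = 0" and j: "j \<in> I"
  shows "a p j = 0"
proof (rule ccontr)
  assume nz: "a p j \<noteq> 0"
  let ?x = "\<lambda>i. if i = j then 1 else 0 :: complex"
  define N where "N = (cmod (a p j))\<^sup>2"
  have N: "N > 0" using nz by (simp add: N_def)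
  define c where "c = (cmod (a j j) + 1) / N"
  define t where "t = - (of_real c * a p j)"
  have L: "(\<Sum>i\<in>I. a p i * ?x i) = a p j"
    using assms(2) j by (simp add: if_distrib cong: if_cong)
  have "(\<Sum>i\<in>I. \<Sum>k\<in>I. cnj (?x i) * a i k * ?x k)
      = (\<Sum>i\<in>I. if i = j then \<Sum>k\<in>I. if k = j then a i k else 0 else 0)"
    by (intro sum.cong refl) (auto intro!: sum.cong)
  also have "\<dots> = a j j"
    using assms(2) j by simp
  finally have Q: "(\<Sum>i\<in>I. \<Sum>k\<in>I. cnj (?x i) * a i k * ?x k) = a j j" .
  have "0 \<le> cnj t * a p j + t * cnj (a p j) + a j j"
    using psd_kernel_insert_nonneg[OF assms(1-3), of t ?x] unfolding L Q zero by simp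
  then have "0 \<le> Re (cnj t * a p j + t * cnj (a p j) + a j j)"
    by (simp add: less_eq_complex_def)
  also have "\<dots> = - 2 * c * N + Re (a j j)"
    unfolding t_def N_def by (simp add: cmod_def power2_eq_square algebra_simps)
  also have "\<dots> = - 2 * (cmod (a j j) + 1) + Re (a j j)"
    using N by (simp add: c_def)
  also have "\<dots> < 0"
    using complex_Re_le_cmod[of "a j j"] by (smt (verit) norm_ge_zero)
  finally show False by simp
qed

text \<open>
  The Schur complement's form at \<open>x\<close> is the value of the original form at the minimising pivot
  coordinate \<open>- L / a p p\<close>.
\<close>

lemma psd_kernel_schur_complement:
  fixes a :: "'i \<Rightarrow> 'i \<Rightarrow> complex"
  assumes psd: "psd_kernel (insert p I) a" and I: "finite I" "p \<notin> I" and nz: "a p p \<noteq> 0"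
  shows "psd_kernel I (\<lambda>i j. a i j - a i p * a p j / a p p)"
  unfolding psd_kernel_def
proof (intro conjI ballI allI)
  note herm = psd_kernel_cnj[OF psd]
  fix i j assume ij: "i \<in> I" "j \<in> I"
  show "cnj (a i j - a i p * a p j / a p p) = a j i - a j p * a p i / a p p"
    using ij by (simp add: herm mult_ac)
next
  note herm = psd_kernel_cnj[OF psd]
  have real: "cnj (a p p) = a p p"
    by (simp add: herm)
  fix x
  define L where "L = (\<Sum>j\<in>I. a p j * x j)"
  have cL: "cnj L = (\<Sum>i\<in>I. cnj (x i) * a i p)"
    unfolding L_def cnj_sum using herm by (intro sum.cong) auto
  have "0 \<le> (- L / a p p) * cnj (- L / a p p) * a p p + cnj (- L / a p p) * L
           + (- L / a p p) * cnj L + (\<Sum>i\<in>I. \<Sum>j\<in>I. cnj (x i) * a i j * x j)"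
    unfolding L_def by (rule psd_kernel_insert_nonneg[OF psd I])
  also have "\<dots> = (\<Sum>i\<in>I. \<Sum>j\<in>I. cnj (x i) * a i j * x j) - cnj L * L / a p p"
    using nz by (simp add: real field_simps)
  also have "\<dots> = (\<Sum>i\<in>I. \<Sum>j\<in>I. cnj (x i) * (a i j - a i p * a p j / a p p) * x j)"
    unfolding cL unfolding L_def sum_product sum_divide_distrib sum_subtractf[symmetric]
    by (simp add: algebra_simps)
  finally show "0 \<le> (\<Sum>i\<in>I. \<Sum>j\<in>I. cnj (x i) * (a i j - a i p * a p j / a p p) * x j)" .
qed

text \<open>
  Cholesky elimination: the pivot column, divided by the root of the pivot, is one of the vectors,
  and the Schur complement supplies the others, extended by 0 at the pivot.
\<close>

lemma psd_kernel_imp_gram: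
  assumes "finite I" "psd_kernel I a"
  shows "\<exists>us. \<forall>i\<in>I. \<forall>j\<in>I. a i j = gram_kernel us i j"
  using assms
proof (induction I arbitrary: a rule: finite_induct)
  case empty
  show ?case by simp
next
  case (insert p I)
  note herm = psd_kernel_cnj[OF insert.prems]
  have ext: "gram_kernel (map (\<lambda>u. u(p := 0)) us) i j = (if i = p \<or> j = p then 0 else gram_kernel us i j)"
    for us i j by (induction us) (auto simp: gram_kernel_def)
  show ?case
  proof (cases "a p p = 0")
    case True
    obtain us where us: "\<forall>i\<in>I. \<forall>j\<in>I. a i j = gram_kernel us i j"
      using insert.IH[OF psd_kernel_subset[OF insert.prems insert.hyps]] by blast
    have row: "a p j = 0" if "j \<in> insert p I" for j
      using psd_kernel_zero_pivot[OF insert.prems insert.hyps True] True that by blast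
    have col: "a i p = 0" if "i \<in> insert p I" for i
      using herm[of p i] row[of i] that by simp
    show ?thesis
      by (rule exI[of _ "map (\<lambda>u. u(p := 0)) us"]) (use us row col ext insert.hyps in auto)
  next
    case False
    obtain us where us: "\<forall>i\<in>I. \<forall>j\<in>I. a i j - a i p * a p j / a p p = gram_kernel us i j"
      using insert.IH[OF psd_kernel_schur_complement[OF insert.prems insert.hyps False]] by blast
    have nonneg: "0 \<le> a p p"
      using psd_kernel_insert_nonneg[OF insert.prems insert.hyps, of 1 "\<lambda>_. 0"] by simp
    define s where "s = complex_of_real (sqrt (Re (a p p)))"
    have s: "s * cnj s = a p p"
      using nonneg by (simp add: s_def less_eq_complex_def complex_eq_iff)
    have pivot: "a i p / s * cnj (a j p / s) = a i p * a p j / a p p" if "j \<in> insert p I" for i j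
      using that by (simp add: s herm)
    have "a i j = gram_kernel ((\<lambda>i. a i p / s) # map (\<lambda>u. u(p := 0)) us) i j"
      if "i \<in> insert p I" "j \<in> insert p I" for i j
    proof -
      have "gram_kernel ((\<lambda>i. a i p / s) # map (\<lambda>u. u(p := 0)) us) i j
          = a i p * a p j / a p p + (if i = p \<or> j = p then 0 else gram_kernel us i j)"
        using pivot[OF that(2), of i] ext[of us i j] by (simp add: gram_kernel_def)
      also have "\<dots> = a i j"
        using us that False by (auto simp flip: us[rule_format])
      finally show ?thesis ..
    qed
    then show ?thesis by blast
  qed
qed

section \<open>Positive semidefinite matrices and Kronecker products\<close>

lemma mat_adjoint_index:
  assumes "X \<in> carrier_mat d d" "i < d" "j < d"
  shows "mat_adjoint X $$ (i, j) = cnj (X $$ (j, i))"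
  using assms by (simp add: mat_adjoint_def mat_of_rows_def)

lemma hermitian_iff:
  assumes "X \<in> carrier_mat d d"
  shows "hermitian X \<longleftrightarrow> (\<forall>i<d. \<forall>j<d. cnj (X $$ (i, j)) = X $$ (j, i))"
proof
  assume "hermitian X"
  then show "\<forall>i<d. \<forall>j<d. cnj (X $$ (i, j)) = X $$ (j, i)"
    using mat_adjoint_index[OF assms] unfolding hermitian_def by metis
next
  assume "\<forall>i<d. \<forall>j<d. cnj (X $$ (i, j)) = X $$ (j, i)"
  then show "hermitian X"
    unfolding hermitian_def using assms mat_adjoint_index[OF assms]
    by (intro eq_matI) (auto simp: mat_adjoint_def)
qed

lemma quadratic_form_eq:
  assumes "X \<in> carrier_mat d d" "v \<in> carrier_vec d"
  shows "(X *\<^sub>v v) \<bullet>c v = (\<Sum>i<d. \<Sum>j<d. cnj (v $ i) * X $$ (i, j) * v $ j)"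
  using assms
  by (auto simp: scalar_prod_def sum_distrib_left sum_distrib_right mult_ac atLeast0LessThan
      intro!: sum.cong)

lemma positive_semidefinite_iff_psd_kernel:
  assumes "X \<in> carrier_mat d d"
  shows "positive_semidefinite X \<longleftrightarrow> psd_kernel {..<d} (\<lambda>i j. X $$ (i, j))"
proof -
  have "(\<forall>v\<in>carrier_vec d. 0 \<le> (X *\<^sub>v v) \<bullet>c v) \<longleftrightarrow>
        (\<forall>x. 0 \<le> (\<Sum>i<d. \<Sum>j<d. cnj (x i) * X $$ (i, j) * x j))" (is "?L \<longleftrightarrow> ?R")
  proof
    assume L: ?L
    show ?R
    proof
      fix x :: "nat \<Rightarrow> complex"
      have "0 \<le> (X *\<^sub>v vec d x) \<bullet>c vec d x" using L by simp
      then show "0 \<le> (\<Sum>i<d. \<Sum>j<d. cnj (x i) * X $$ (i, j) * x j)"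
        by (simp add: quadratic_form_eq[OF assms])
    qed
  qed (use quadratic_form_eq[OF assms] in auto)
  then show ?thesis
    using assms unfolding positive_semidefinite_def psd_kernel_def hermitian_iff[OF assms] by auto
qed

lemma positive_semidefinite_gramI:
  assumes "X \<in> carrier_mat d d"
    and "\<And>i j. i < d \<Longrightarrow> j < d \<Longrightarrow> X $$ (i, j) = gram_kernel us i j"
  shows "positive_semidefinite X"
  unfolding positive_semidefinite_iff_psd_kernel[OF assms(1)]
  using psd_kernel_gram[of "{..<d}" us] assms(2)
  by (subst psd_kernel_cong[of _ _ "gram_kernel us"]) auto

lemma kronecker_index:
  assumes "X \<in> carrier_mat c c" "Y \<in> carrier_mat e e" "i < c * e" "j < c * e"
  shows "kronecker X Y $$ (i, j) = X $$ (i div e, j div e) * Y $$ (i mod e, j mod e)"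
  using assms by (simp add: kronecker_def)

lemma div_mod_less_mult:
  assumes "i < c * (e::nat)"
  shows "i div e < c" "i mod e < e"
  using assms by (auto simp: less_mult_imp_div_less intro!: mod_less_divisor Nat.gr0I)

text \<open>
  Gram vectors \<open>u\<close> of \<open>X\<close> and \<open>v\<close> of \<open>Y\<close> give the Gram vectors \<open>u \<otimes> v\<close> of the Kronecker product.
\<close>

lemma positive_semidefinite_kronecker:
  assumes X: "X \<in> carrier_mat c c" "positive_semidefinite X"
    and Y: "Y \<in> carrier_mat e e" "positive_semidefinite Y"
  shows "positive_semidefinite (kronecker X Y)"
proof -
  obtain us where us: "\<forall>i<c. \<forall>j<c. X $$ (i, j) = gram_kernel us i j"
    using psd_kernel_imp_gram[OF finite_lessThan] X(2)
    unfolding positive_semidefinite_iff_psd_kernel[OF X(1)] by fastforce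
  obtain vs where vs: "\<forall>i<e. \<forall>j<e. Y $$ (i, j) = gram_kernel vs i j"
    using psd_kernel_imp_gram[OF finite_lessThan] Y(2)
    unfolding positive_semidefinite_iff_psd_kernel[OF Y(1)] by fastforce
  define ws where "ws = concat (map (\<lambda>u. map (\<lambda>v i. u (i div e) * v (i mod e)) vs) us)"
  have inner: "gram_kernel (map (\<lambda>v i. u (i div e) * v (i mod e)) vs) i j
      = u (i div e) * cnj (u (j div e)) * gram_kernel vs (i mod e) (j mod e)" for u i j
    by (induction vs) (auto simp: gram_kernel_def algebra_simps)
  have outer: "gram_kernel ws i j = gram_kernel us (i div e) (j div e) * gram_kernel vs (i mod e) (j mod e)"
    for i j unfolding ws_def
  proof (induction us)
    case (Cons u us)
    then show ?case
      using inner[of u i j] by (simp add: gram_kernel_def algebra_simps)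
  qed (simp add: gram_kernel_def)
  have "kronecker X Y $$ (i, j) = gram_kernel ws i j" if "i < c * e" "j < c * e" for i j
    using us vs div_mod_less_mult that by (simp add: kronecker_index[OF X(1) Y(1)] outer)
  then show ?thesis
    by (rule positive_semidefinite_gramI[OF kronecker_carrier[OF X(1) Y(1)]])
qed

section \<open>Expansion of the tensor power of a sum over words\<close>

primrec kronecker_word :: "('i \<Rightarrow> complex mat) \<Rightarrow> 'i list \<Rightarrow> complex mat" where
  "kronecker_word A [] = 1\<^sub>m 1"
| "kronecker_word A (i # w) = kronecker (A i) (kronecker_word A w)"

definition words :: "'i set \<Rightarrow> nat \<Rightarrow> 'i list set" where
  "words I p = {w. set w \<subseteq> I \<and> length w = p}"

lemma kronecker_word_carrier:
  assumes "\<And>i. i \<in> set w \<Longrightarrow> A i \<in> carrier_mat d d"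
  shows "kronecker_word A w \<in> carrier_mat (d ^ length w) (d ^ length w)"
  using assms by (induction w) (auto intro: kronecker_carrier)

lemma positive_semidefinite_one: "positive_semidefinite (1\<^sub>m 1)"
  by (rule positive_semidefinite_gramI[of _ 1 "[\<lambda>_. 1]"]) (auto simp: gram_kernel_def)

lemma positive_semidefinite_kronecker_word:
  assumes "\<And>i. i \<in> set w \<Longrightarrow> A i \<in> carrier_mat d d"
    and "\<And>i. i \<in> set w \<Longrightarrow> positive_semidefinite (A i)"
  shows "positive_semidefinite (kronecker_word A w)"
  using assms
proof (induction w)
  case Nil
  show ?case using positive_semidefinite_one by simp
next
  case (Cons i w)
  then have "kronecker_word A w \<in> carrier_mat (d ^ length w) (d ^ length w)"
    by (intro kronecker_word_carrier) auto
  with Cons show ?case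
    unfolding kronecker_word.simps by (intro positive_semidefinite_kronecker) auto
qed

lemma words_Suc: "words I (Suc p) = (\<lambda>(i, w). i # w) ` (I \<times> words I p)"
  unfolding words_def by (auto simp: length_Suc_conv image_iff)

lemma finite_words: "finite I \<Longrightarrow> finite (words I p)"
  unfolding words_def by (rule finite_lists_length_eq)

text \<open>
  Multilinearity of the Kronecker product, stated entrywise: choosing one summand in each of the \<open>p\<close>
  factors amounts to choosing a word.
\<close>

lemma kronecker_power_msum_index:
  assumes I: "finite I" and A: "\<And>i. i \<in> I \<Longrightarrow> A i \<in> carrier_mat d d"
    and "a < d ^ p" "b < d ^ p"
  shows "kronecker_power (msum d A I) p $$ (a, b) = (\<Sum>w\<in>words I p. kronecker_word A w $$ (a, b))"
  using assms(3,4)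
proof (induction p arbitrary: a b)
  case 0
  have "words I 0 = {[]}" by (auto simp: words_def)
  then show ?case by simp
next
  case (Suc p)
  let ?e = "d ^ p"
  have ab: "a < d * ?e" "b < d * ?e" using Suc.prems by simp_all
  note carr = kronecker_power_carrier[OF msum_carrier[OF A]]
  have "kronecker_power (msum d A I) (Suc p) $$ (a, b)
      = (\<Sum>i\<in>I. A i $$ (a div ?e, b div ?e))
        * (\<Sum>w\<in>words I p. kronecker_word A w $$ (a mod ?e, b mod ?e))"
    using ab div_mod_less_mult
    by (simp add: kronecker_index[OF msum_carrier[OF A] carr] Suc.IH msum_index[OF I A])
  also have "\<dots> = (\<Sum>(i, w)\<in>I \<times> words I p.
      A i $$ (a div ?e, b div ?e) * kronecker_word A w $$ (a mod ?e, b mod ?e))"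
    by (simp add: sum_product sum.cartesian_product)
  also have "\<dots> = (\<Sum>(i, w)\<in>I \<times> words I p. kronecker_word A (i # w) $$ (a, b))"
  proof (intro sum.cong refl, clarify)
    fix i w assume iw: "i \<in> I" "w \<in> words I p"
    have "kronecker_word A w \<in> carrier_mat ?e ?e"
      using kronecker_word_carrier[of w A d] A iw by (auto simp: words_def)
    then show "A i $$ (a div ?e, b div ?e) * kronecker_word A w $$ (a mod ?e, b mod ?e)
        = kronecker_word A (i # w) $$ (a, b)"
      using kronecker_index[OF A _ ab] iw by simp
  qed
  also have "\<dots> = (\<Sum>w\<in>words I (Suc p). kronecker_word A w $$ (a, b))"
    unfolding words_Suc by (subst sum.reindex) (auto simp: inj_on_def case_prod_beta)
  finally show ?case .
qed

lemma S_sum_carrier: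
  assumes "\<And>i. i \<in> {1..n} \<Longrightarrow> A i \<in> carrier_mat d d"
  shows "S_sum d A n p r \<in> carrier_mat (d ^ p) (d ^ p)"
  unfolding S_sum_def using assms
  by (intro msum_carrier kronecker_power_carrier) auto

text \<open>
  Exchanging the sum over the sets \<open>I\<close> with the sum over words: a word is counted once for each \<open>I\<close>
  that contains all its letters.
\<close>

lemma S_sum_index:
  assumes A: "\<And>i. i \<in> {1..n} \<Longrightarrow> A i \<in> carrier_mat d d" and ab: "a < d ^ p" "b < d ^ p"
  shows "S_sum d A n p r $$ (a, b) = (\<Sum>w\<in>words {1..n} p.
     of_nat (card {I. I \<subseteq> {1..n} \<and> card I = r \<and> set w \<subseteq> I}) * kronecker_word A w $$ (a, b))"
proof -
  let ?P = "{I. I \<subseteq> {1..n} \<and> card I = r}"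
  have fin: "finite ?P" by (rule finite_subset[of _ "Pow {1..n}"]) auto
  have "S_sum d A n p r $$ (a, b) = (\<Sum>I\<in>?P. kronecker_power (msum d A I) p $$ (a, b))"
    unfolding S_sum_def
    using A ab by (intro msum_index fin kronecker_power_carrier msum_carrier) auto
  also have "\<dots> = (\<Sum>I\<in>?P. \<Sum>w\<in>words I p. kronecker_word A w $$ (a, b))"
    using A ab finite_subset[of _ "{1..n}"]
    by (intro sum.cong refl kronecker_power_msum_index) auto
  also have "\<dots> = (\<Sum>I\<in>?P. \<Sum>w | w \<in> words {1..n} p \<and> set w \<subseteq> I. kronecker_word A w $$ (a, b))"
    by (intro sum.cong refl) (auto simp: words_def)
  also have "\<dots> = (\<Sum>w\<in>words {1..n} p. \<Sum>I | I \<in> ?P \<and> set w \<subseteq> I. kronecker_word A w $$ (a, b))"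
    by (rule sum.swap_restrict[OF fin finite_words]) simp
  also have "\<dots> = (\<Sum>w\<in>words {1..n} p.
     of_nat (card {I. I \<subseteq> {1..n} \<and> card I = r \<and> set w \<subseteq> I}) * kronecker_word A w $$ (a, b))"
    by (simp add: conj_assoc)
  finally show ?thesis .
qed

section \<open>The coefficients\<close>

text \<open>
  A superset of \<open>T\<close> is determined by its part outside \<open>T\<close>, which is arbitrary.
\<close>

lemma card_supersets:
  assumes "finite N" "T \<subseteq> N" "card T \<le> r"
  shows "card {I. I \<subseteq> N \<and> card I = r \<and> T \<subseteq> I} = (card N - card T) choose (r - card T)"
proof -
  have T: "finite T" using assms finite_subset by blast
  have "bij_betw (\<lambda>J. J \<union> T) {J. J \<subseteq> N - T \<and> card J = r - card T} {I. I \<subseteq> N \<and> card I = r \<and> T \<subseteq> I}"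
  proof (rule bij_betw_byWitness[where f' = "\<lambda>I. I - T"])
    show "(\<lambda>J. J \<union> T) ` {J. J \<subseteq> N - T \<and> card J = r - card T} \<subseteq> {I. I \<subseteq> N \<and> card I = r \<and> T \<subseteq> I}"
    proof clarify
      fix J assume J: "J \<subseteq> N - T" "card J = r - card T"
      then have "card (J \<union> T) = r"
        using assms T finite_subset[of J N] by (subst card_Un_disjoint) auto
      then show "J \<union> T \<subseteq> N \<and> card (J \<union> T) = r \<and> T \<subseteq> J \<union> T" using J assms by auto
    qed
    show "(\<lambda>I. I - T) ` {I. I \<subseteq> N \<and> card I = r \<and> T \<subseteq> I} \<subseteq> {J. J \<subseteq> N - T \<and> card J = r - card T}"
      using T by (auto simp: card_Diff_subset)
  qed auto
  then show ?thesis
    using assms T by (simp add: n_subsets card_Diff_subset flip: bij_betw_same_card)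
qed

text \<open>
  Two binomial identities make the coefficient simple:
  \<open>(n choose r) (r choose s) = (n choose s) ((n - s) choose (r - s))\<close> removes the dependence of the
  denominator on \<open>n choose r\<close>, and the absorption rule
  \<open>s (r choose s) = r ((r - 1) choose (s - 1))\<close> cancels the factor \<open>r\<close>. For \<open>r < s\<close> both sides vanish.
\<close>

lemma normalised_count:
  assumes N: "finite N" "T \<subseteq> N" "T \<noteq> {}" and r: "1 \<le> r" "r \<le> card N"
  shows "real (card {I. I \<subseteq> N \<and> card I = r \<and> T \<subseteq> I}) / (real r * real (card N choose r))
       = real ((r - 1) choose (card T - 1)) / (real (card T) * real (card N choose card T))"
proof -
  let ?n = "card N" and ?s = "card T"
  let ?c = "card {I. I \<subseteq> N \<and> card I = r \<and> T \<subseteq> I}"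
  have T: "finite T" using N finite_subset by blast
  have s: "1 \<le> ?s" "?s \<le> ?n" using N T card_mono[OF N(1,2)] by (simp_all add: Suc_le_eq card_gt_0_iff)
  have count: "(?n choose r) * (r choose ?s) = (?n choose ?s) * ?c"
  proof (cases "?s \<le> r")
    case True
    show ?thesis unfolding card_supersets[OF N(1,2) True] by (rule choose_mult[OF True r(2)])
  next
    case False
    have "{I. I \<subseteq> N \<and> card I = r \<and> T \<subseteq> I} = {}"
    proof -
      have "?s \<le> card I" if "I \<subseteq> N" "T \<subseteq> I" for I
        using card_mono[OF finite_subset[OF that(1) N(1)] that(2)] .
      then show ?thesis using False by blast
    qed
    then have "?c = 0" by (simp only: card.empty)
    then show ?thesis using False by (simp add: binomial_eq_0)
  qed
  have absorb: "?s * (r choose ?s) = r * ((r - 1) choose (?s - 1))"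
    using times_binomial_minus1_eq[of ?s r] s by simp
  have pos: "0 < real r" "0 < real (?n choose r)" "0 < real ?s" "0 < real (?n choose ?s)"
    using r s by auto
  have "real ?c * (real ?s * real (?n choose ?s))
      = real ?s * real ((?n choose ?s) * ?c)" by simp
  also have "\<dots> = real (?n choose r) * real (?s * (r choose ?s))"
    unfolding count[symmetric] by simp
  also have "\<dots> = real ((r - 1) choose (?s - 1)) * (real r * real (?n choose r))"
    unfolding absorb by simp
  finally show ?thesis
    using pos by (simp add: frac_eq_eq)
qed

text \<open>
  All increments of \<open>h\<close> below \<open>l\<close> are at most \<open>D l\<close>, and all those from \<open>l\<close> on are at least \<open>D l\<close>;
  so the mean slope over \<open>k, l\<close> does not exceed the mean slope over \<open>l, m\<close>.
\<close>

lemma convex_sequence_secant: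
  fixes h :: "nat \<Rightarrow> real"
  assumes conv: "\<And>i. k \<le> i \<Longrightarrow> h (Suc i) - h i \<le> h (Suc (Suc i)) - h (Suc i)"
    and "k < l" "l < m"
  shows "(real m - real k) * h l \<le> (real m - real l) * h k + (real l - real k) * h m"
proof -
  define D where "D i = h (Suc i) - h i" for i
  have mono: "D i \<le> D j" if "k \<le> i" "i \<le> j" for i j
    using that(2)
  proof (induction j rule: dec_induct)
    case (step q)
    have "D q \<le> D (Suc q)" using conv[of q] step.hyps that(1) by (simp add: D_def)
    then show ?case using step.IH by simp
  qed simp
  have tele: "h j - h i = (\<Sum>q=i..<j. D q)" if "i \<le> j" for i j
    using sum_Suc_diff'[OF that, of h] by (simp add: D_def)
  have lower: "h l - h k \<le> (real l - real k) * D l"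
    using sum_bounded_above[of "{k..<l}" D "D l"] mono assms(2) by (simp add: tele of_nat_diff)
  have upper: "(real m - real l) * D l \<le> h m - h l"
    using sum_bounded_below[of "{l..<m}" "D l" D] mono assms(2,3) by (simp add: tele of_nat_diff)
  have "(real m - real l) * (h l - h k) \<le> (real m - real l) * ((real l - real k) * D l)"
    using lower assms by (intro mult_left_mono) auto
  also have "\<dots> = (real l - real k) * ((real m - real l) * D l)" by simp
  also have "\<dots> \<le> (real l - real k) * (h m - h l)"
    using upper assms by (intro mult_left_mono) auto
  finally show ?thesis by (simp add: algebra_simps)
qed

text \<open>
  By Pascal's rule the increments are binomial coefficients with lower index \<open>c - 1\<close> and growing upper
  index. At \<open>i = 0\<close>, where truncated subtraction gives two equal values, the first increment is 0.
\<close>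

lemma binomial_pred_convex:
  "real ((Suc i - 1) choose c) - real ((i - 1) choose c)
     \<le> real ((Suc (Suc i) - 1) choose c) - real ((Suc i - 1) choose c)"
proof (cases c)
  case (Suc b)
  show ?thesis
  proof (cases i)
    case (Suc j)
    then show ?thesis using binomial_right_mono[of j "Suc j" b] \<open>c = Suc b\<close> by simp
  qed (simp add: Suc)
qed simp

section \<open>The inequality\<close>

text \<open>
  The combination is described through its entries, in the form in which the expansion over words
  produces it.
\<close>

lemma positive_semidefinite_weighted_sum:
  fixes X :: "complex mat" and c :: "'w \<Rightarrow> real"
  assumes X: "X \<in> carrier_mat d d"
    and K: "\<And>w. w \<in> W \<Longrightarrow> K w \<in> carrier_mat d d" "\<And>w. w \<in> W \<Longrightarrow> positive_semidefinite (K w)"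
    and c: "\<And>w. w \<in> W \<Longrightarrow> 0 \<le> c w"
    and eq: "\<And>a b. a < d \<Longrightarrow> b < d \<Longrightarrow> X $$ (a, b) = (\<Sum>w\<in>W. complex_of_real (c w) * K w $$ (a, b))"
  shows "positive_semidefinite X"
proof -
  have K': "psd_kernel {..<d} (\<lambda>i j. K w $$ (i, j))" if "w \<in> W" for w
    using K that positive_semidefinite_iff_psd_kernel by blast
  have "psd_kernel {..<d} (\<lambda>i j. X $$ (i, j))"
    unfolding psd_kernel_def
  proof (intro conjI ballI allI)
    fix i j assume "i \<in> {..<d}" "j \<in> {..<d}"
    then show "cnj (X $$ (i, j)) = X $$ (j, i)"
      using K' unfolding psd_kernel_def by (simp add: eq)
  next
    fix x :: "nat \<Rightarrow> complex"
    have "0 \<le> (\<Sum>w\<in>W. complex_of_real (c w) * (\<Sum>i<d. \<Sum>j<d. cnj (x i) * K w $$ (i, j) * x j))"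
    proof (intro sum_nonneg[of W])
      fix w assume w: "w \<in> W"
      have "0 \<le> complex_of_real (c w)" using c[OF w] by (simp add: less_eq_complex_def)
      moreover have "0 \<le> (\<Sum>i<d. \<Sum>j<d. cnj (x i) * K w $$ (i, j) * x j)"
        using K'[OF w] unfolding psd_kernel_def by blast
      ultimately show "0 \<le> complex_of_real (c w) * (\<Sum>i<d. \<Sum>j<d. cnj (x i) * K w $$ (i, j) * x j)"
        by (rule mult_nonneg_nonneg)
    qed
    also have "\<dots> = (\<Sum>w\<in>W. \<Sum>i<d. \<Sum>j<d. cnj (x i) * (complex_of_real (c w) * K w $$ (i, j)) * x j)"
      by (simp add: sum_distrib_left mult_ac)
    also have "\<dots> = (\<Sum>i<d. \<Sum>j<d. \<Sum>w\<in>W. cnj (x i) * (complex_of_real (c w) * K w $$ (i, j)) * x j)"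
      by (subst sum.swap, intro sum.cong refl, rule sum.swap)
    also have "\<dots> = (\<Sum>i<d. \<Sum>j<d. cnj (x i) * X $$ (i, j) * x j)"
      by (intro sum.cong refl) (simp add: eq sum_distrib_left sum_distrib_right)
    finally show "0 \<le> (\<Sum>i\<in>{..<d}. \<Sum>j\<in>{..<d}. cnj (x i) * X $$ (i, j) * x j)" .
  qed
  then show ?thesis using X positive_semidefinite_iff_psd_kernel by blast
qed

theorem theorem4p8:
  fixes n p d k l m :: nat and A :: "nat \<Rightarrow> complex mat"
  assumes "n \<ge> 1" and "p \<ge> 1"
    and "\<And>i. i \<in> {1..n} \<Longrightarrow> A i \<in> carrier_mat d d"
    and "\<And>i. i \<in> {1..n} \<Longrightarrow> positive_semidefinite (A i)"
    and "1 \<le> k" and "k < l" and "l < m" and "m \<le> n"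
  shows "complex_of_real ((real m - real l) / (real k * real (n choose k))) \<cdot>\<^sub>m S_sum d A n p k
       + complex_of_real ((real l - real k) / (real m * real (n choose m))) \<cdot>\<^sub>m S_sum d A n p m
     \<ge>\<^sub>L complex_of_real ((real m - real k) / (real l * real (n choose l))) \<cdot>\<^sub>m S_sum d A n p l"
proof -
  let ?W = "words {1..n} p" and ?D = "d ^ p"
  note A = assms(3)
  have range: "1 \<le> k" "k \<le> n" "1 \<le> l" "l \<le> n" "1 \<le> m" "m \<le> n"
    using assms by auto
  \<comment> \<open>the coefficient, in the normalised sum for \<open>r\<close>, of a word with \<open>s\<close> distinct letters\<close>
  define g where "g s r = real ((r - 1) choose (s - 1)) / (real s * real (n choose s))" for s r
  have word: "kronecker_word A w \<in> carrier_mat ?D ?D" "positive_semidefinite (kronecker_word A w)"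
    if "w \<in> ?W" for w
  proof -
    have w: "set w \<subseteq> {1..n}" "length w = p" using that by (auto simp: words_def)
    have "A i \<in> carrier_mat d d" "positive_semidefinite (A i)" if "i \<in> set w" for i
      using assms(3,4) w(1) that by blast+
    then show "kronecker_word A w \<in> carrier_mat ?D ?D" "positive_semidefinite (kronecker_word A w)"
      using kronecker_word_carrier[of w A d] positive_semidefinite_kronecker_word[of w A d] w(2)
      by blast+
  qed
  have S: "S_sum d A n p r \<in> carrier_mat ?D ?D" for r
    by (rule S_sum_carrier[OF A])
  have scaled: "(complex_of_real (\<gamma> / (real r * real (n choose r))) \<cdot>\<^sub>m S_sum d A n p r) $$ (a, b)
      = (\<Sum>w\<in>?W. complex_of_real (\<gamma> * g (card (set w)) r) * kronecker_word A w $$ (a, b))"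
    if r: "1 \<le> r" "r \<le> n" and ab: "a < ?D" "b < ?D" for \<gamma> r a b
  proof -
    have coeff: "complex_of_real (\<gamma> / (real r * real (n choose r)))
          * of_nat (card {I. I \<subseteq> {1..n} \<and> card I = r \<and> set w \<subseteq> I})
        = complex_of_real (\<gamma> * g (card (set w)) r)" if "w \<in> ?W" for w
    proof -
      have "set w \<subseteq> {1..n}" "set w \<noteq> {}" using that assms(2) by (auto simp: words_def)
      then have "g (card (set w)) r = real (card {I. I \<subseteq> {1..n} \<and> card I = r \<and> set w \<subseteq> I})
          / (real r * real (n choose r))"
        using normalised_count[of "{1..n}" "set w" r] r by (simp add: g_def)
      then show ?thesis by simp
    qed
    have "(complex_of_real (\<gamma> / (real r * real (n choose r))) \<cdot>\<^sub>m S_sum d A n p r) $$ (a, b)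
        = complex_of_real (\<gamma> / (real r * real (n choose r))) * S_sum d A n p r $$ (a, b)"
      using S[of r] ab by simp
    also have "\<dots> = (\<Sum>w\<in>?W. complex_of_real (\<gamma> / (real r * real (n choose r)))
        * of_nat (card {I. I \<subseteq> {1..n} \<and> card I = r \<and> set w \<subseteq> I}) * kronecker_word A w $$ (a, b))"
      by (subst S_sum_index) (use A ab in \<open>simp_all add: sum_distrib_left mult.assoc\<close>)
    also have "\<dots> = (\<Sum>w\<in>?W. complex_of_real (\<gamma> * g (card (set w)) r) * kronecker_word A w $$ (a, b))"
      by (intro sum.cong refl) (simp only: coeff)
    finally show ?thesis .
  qed
  define X where "X = complex_of_real ((real m - real l) / (real k * real (n choose k))) \<cdot>\<^sub>m S_sum d A n p k
       + complex_of_real ((real l - real k) / (real m * real (n choose m))) \<cdot>\<^sub>m S_sum d A n p m"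
  define Y where "Y = complex_of_real ((real m - real k) / (real l * real (n choose l))) \<cdot>\<^sub>m S_sum d A n p l"
  have carr: "X \<in> carrier_mat ?D ?D" "Y \<in> carrier_mat ?D ?D"
    unfolding X_def Y_def using S by auto
  have X: "X $$ (a, b) = (\<Sum>w\<in>?W. complex_of_real ((real m - real l) * g (card (set w)) k
        + (real l - real k) * g (card (set w)) m) * kronecker_word A w $$ (a, b))"
    if "a < ?D" "b < ?D" for a b
  proof -
    have "X $$ (a, b)
        = (complex_of_real ((real m - real l) / (real k * real (n choose k))) \<cdot>\<^sub>m S_sum d A n p k) $$ (a, b)
        + (complex_of_real ((real l - real k) / (real m * real (n choose m))) \<cdot>\<^sub>m S_sum d A n p m) $$ (a, b)"
      unfolding X_def using S[of m] that by (intro index_add_mat) auto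
    also have "\<dots> = (\<Sum>w\<in>?W. complex_of_real ((real m - real l) * g (card (set w)) k
        + (real l - real k) * g (card (set w)) m) * kronecker_word A w $$ (a, b))"
      by (simp only: scaled[OF range(1,2) that] scaled[OF range(5,6) that]
          of_real_add distrib_right sum.distrib)
    finally show ?thesis .
  qed
  have Y: "Y $$ (a, b) = (\<Sum>w\<in>?W. complex_of_real ((real m - real k) * g (card (set w)) l)
        * kronecker_word A w $$ (a, b))" if "a < ?D" "b < ?D" for a b
    unfolding Y_def by (rule scaled[OF range(3,4) that])
  have XY: "(X - Y) $$ (a, b) = (\<Sum>w\<in>?W. complex_of_real ((real m - real l) * g (card (set w)) k
        + (real l - real k) * g (card (set w)) m - (real m - real k) * g (card (set w)) l)
        * kronecker_word A w $$ (a, b))" if "a < ?D" "b < ?D" for a b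
  proof -
    have "(X - Y) $$ (a, b) = X $$ (a, b) - Y $$ (a, b)"
      using that carr by simp
    then show ?thesis
      by (simp only: X[OF that] Y[OF that] of_real_diff left_diff_distrib sum_subtractf)
  qed
  have convex: "0 \<le> (real m - real l) * g s k + (real l - real k) * g s m - (real m - real k) * g s l" for s
  proof -
    have "(real m - real k) * real ((l - 1) choose (s - 1))
        \<le> (real m - real l) * real ((k - 1) choose (s - 1)) + (real l - real k) * real ((m - 1) choose (s - 1))"
      using convex_sequence_secant[of k "\<lambda>r. real ((r - 1) choose (s - 1))" l m]
        binomial_pred_convex assms by fastforce
    then have "0 \<le> ((real m - real l) * real ((k - 1) choose (s - 1))
        + (real l - real k) * real ((m - 1) choose (s - 1))
        - (real m - real k) * real ((l - 1) choose (s - 1))) / (real s * real (n choose s))"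
      by (intro divide_nonneg_nonneg) auto
    then show ?thesis by (simp add: g_def diff_divide_distrib add_divide_distrib)
  qed
  have g: "0 \<le> g s r" for s r by (simp add: g_def)
  \<comment> \<open>positivity of both sides themselves yields that they are hermitian, as the Loewner order demands\<close>
  have "positive_semidefinite X"
    using assms g by (intro positive_semidefinite_weighted_sum[OF carr(1) word _ X]) auto
  moreover have "positive_semidefinite Y"
    using assms g by (intro positive_semidefinite_weighted_sum[OF carr(2) word _ Y]) auto
  moreover have "positive_semidefinite (X - Y)"
    using convex carr by (intro positive_semidefinite_weighted_sum[OF _ word _ XY]) auto
  ultimately show ?thesis
    using carr unfolding loewner_ge_def X_def[symmetric] Y_def[symmetric]
    by (simp add: positive_semidefinite_def)
qed

end
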